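(* Let $n\ge2$ and let $0\le\alpha_1<\dots<\alpha_n$ be integers. If a correct score sequence for $D=\{\alpha_1,\dots,\alpha_n\}$ exists, i.e. positive integers $x_1,\dots,x_n$ such that the non-decreasing sequence consisting of $\alpha_i$ repeated $x_i$ times ($i=1,\dots,n$) is the score sequence of some tournament, then the fast reconstruction algorithm described in the context, run on $D$, reconstructs a correct score sequence (its main call returns TRUE with $(x_1,\dots,x_n)$ a correct score sequence).
   Context: A tournament is an orientation of a complete graph; its score sequence is its sequence of out-degrees. Fast reconstruction algorithm: let $m=\alpha_n-\alpha_{n-1}$, $a\bmod m$ the least nonnegative residue; $sol=(s_0,\dots,s_{m-1})$ with $s_i=((2\alpha_n+1-2i)i)\bmod m$; $g_i=(\alpha_n-\alpha_i)\bmod m$ ($1\le i\le n-1$); $\mu_i=\gcd(g_i,\dots,g_{n-1},m)$ ($1\le i\le n-1$). Let $\mathrm{cb}(P,Q,a)=\frac{2(a-P)+1+\sqrt{(2(a-P)+1)^2+8(Q-P(P-1)/2)}}{2}$. $\mathrm{potential}(S,\mu)$ is TRUE iff some entry $s$ of $S$ satisfies ($s=0$ and $\mu=0$) or $s\bmod\mu=0$. $\mathrm{end}(i,P,Q)$: let $b_1=(2\alpha_n+1)/2$, $b_2=\mathrm{cb}(P,Q,\alpha_{n-1})$; for $i,\,i+m,\,i+2m,\dots$ as long as the current value $i\le b_1$: let $t_1=\frac{(2\alpha_n+1-2i)i-P\alpha_n+Q}{m}$; if $t_1$ is an integer with $1\le t_1\le b_2$, let $t_2=\mathrm{cb}(P+t_1,Q+t_1\alpha_{n-1},\alpha_n)$,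 and if $t_2$ is an integer with $t_2\ge1$, set $x_n=t_2$, $x_{n-1}=t_1$ and return TRUE; after the loop return FALSE. $\mathrm{rec}(S,\ell,P,Q)$: if $\ell\ge n-1$, then for $i=0,\dots,m-1$, if the $i$-th entry of $S$ is $0$ and $\mathrm{end}(i,P,Q)$ is TRUE, return TRUE; then return FALSE. Otherwise let $b=\mathrm{cb}(P,Q,\alpha_\ell)$; for each integer $i$ from $1$ to $b$: let $sum=\sum_{j=1}^{\ell-1}g_jx_j+g_\ell\, i$ and let $S'$ have $j$-th entry $(S_j-sum)\bmod m$; if $\mathrm{potential}(S',\mu_{\ell+1})$, set $x_\ell=i$ and if $\mathrm{rec}(S',\ell+1,P+i,Q+i\alpha_\ell)$ is TRUE return TRUE; after the loop return FALSE. The main call is $\mathrm{rec}(sol,1,0,0)$.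
   Formalization: In rec, the j-th entry of S' is taken as (s_j − sum) mod m with s_j from the initial vector sol, not from the argument S; with S_j from S the earlier contributions are subtracted repeatedly and the algorithm wrongly returns FALSE on D={0,1,3,5}. *)

theory Defs
  imports Complex_Main "HOL-Library.Multiset"
begin

definition tournament :: "'v set \<Rightarrow> ('v \<times> 'v) set \<Rightarrow> bool" where
  "tournament V T \<longleftrightarrow>
     finite V \<and> T \<subseteq> V \<times> V \<and> (\<forall>v\<in>V. (v, v) \<notin> T) \<and>
     (\<forall>u\<in>V. \<forall>v\<in>V. u \<noteq> v \<longrightarrow> ((u, v) \<in> T \<longleftrightarrow> (v, u) \<notin> T))"

definition out_deg :: "('v \<times> 'v) set \<Rightarrow> 'v \<Rightarrow> nat" where
  "out_deg T v = card {w. (v, w) \<in> T}"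

definition score_sequence :: "'v set \<Rightarrow> ('v \<times> 'v) set \<Rightarrow> nat list" where
  "score_sequence V T = sorted_list_of_multiset (image_mset (out_deg T) (mset_set V))"

definition correct_score_sequence :: "nat \<Rightarrow> (nat \<Rightarrow> int) \<Rightarrow> (nat \<Rightarrow> int) \<Rightarrow> bool" where
  "correct_score_sequence n \<alpha> x \<longleftrightarrow>
     (\<forall>i\<in>{1..n}. x i \<ge> 1) \<and>
     (\<exists>(V :: nat set) T. tournament V T \<and>
        map int (score_sequence V T) = concat (map (\<lambda>i. replicate (nat (x i)) (\<alpha> i)) [1..<Suc n]))"

text \<open>
  The algorithm is imperative. Each procedure takes the current contents of the variables
  \<open>x\<^sub>1, \<dots>, x\<^sub>n\<close> as its last argument and returns its truth value together with their
  contents on exit.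
\<close>

definition fr_m :: "nat \<Rightarrow> (nat \<Rightarrow> int) \<Rightarrow> int" where
  "fr_m n \<alpha> = \<alpha> n - \<alpha> (n - 1)"

definition fr_sol :: "nat \<Rightarrow> (nat \<Rightarrow> int) \<Rightarrow> int list" where
  "fr_sol n \<alpha> = map (\<lambda>i. ((2 * \<alpha> n + 1 - 2 * i) * i) mod fr_m n \<alpha>) [0..fr_m n \<alpha> - 1]"

definition fr_g :: "nat \<Rightarrow> (nat \<Rightarrow> int) \<Rightarrow> nat \<Rightarrow> int" where
  "fr_g n \<alpha> i = (\<alpha> n - \<alpha> i) mod fr_m n \<alpha>"

definition fr_mu :: "nat \<Rightarrow> (nat \<Rightarrow> int) \<Rightarrow> nat \<Rightarrow> int" where
  "fr_mu n \<alpha> i = Gcd (insert (fr_m n \<alpha>) (fr_g n \<alpha> ` {i..n - 1}))"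

definition cb :: "real \<Rightarrow> real \<Rightarrow> real \<Rightarrow> real" where
  "cb P Q a = (2 * (a - P) + 1 + sqrt ((2 * (a - P) + 1)\<^sup>2 + 8 * (Q - P * (P - 1) / 2))) / 2"

definition potential :: "int list \<Rightarrow> int \<Rightarrow> bool" where
  "potential S \<mu> \<longleftrightarrow> (\<exists>s\<in>set S. (s = 0 \<and> \<mu> = 0) \<or> s mod \<mu> = 0)"

text \<open>A for-loop that is left as soon as its body returns \<open>True\<close>.\<close>

fun for_loop :: "'i list \<Rightarrow> ('i \<Rightarrow> 's \<Rightarrow> bool \<times> 's) \<Rightarrow> 's \<Rightarrow> bool \<times> 's" where
  "for_loop [] body x = (False, x)"
| "for_loop (i # is) body x =
     (let (found, x') = body i x in if found then (True, x') else for_loop is body x')"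

text \<open>
  The guard \<open>0 < fr_m n \<alpha>\<close> only makes the function total; it holds whenever \<open>\<alpha>\<close> is strictly
  increasing.
\<close>

function fr_end :: "nat \<Rightarrow> (nat \<Rightarrow> int) \<Rightarrow> int \<Rightarrow> int \<Rightarrow> int \<Rightarrow> (nat \<Rightarrow> int) \<Rightarrow> bool \<times> (nat \<Rightarrow> int)" where
  "fr_end n \<alpha> i P Q x =
     (if 0 < fr_m n \<alpha> \<and> real_of_int i \<le> (2 * real_of_int (\<alpha> n) + 1) / 2 then
        let t1 = real_of_int ((2 * \<alpha> n + 1 - 2 * i) * i - P * \<alpha> n + Q) / real_of_int (fr_m n \<alpha>);
            t2 = cb (P + t1) (Q + t1 * \<alpha> (n - 1)) (\<alpha> n)
        in if t1 \<in> \<int> \<and> 1 \<le> t1 \<and> t1 \<le> cb P Q (\<alpha> (n - 1)) \<and> t2 \<in> \<int> \<and> 1 \<le> t2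
           then (True, x(n := \<lfloor>t2\<rfloor>, n - 1 := \<lfloor>t1\<rfloor>))
           else fr_end n \<alpha> (i + fr_m n \<alpha>) P Q x
      else (False, x))"
  by pat_completeness auto
termination
  by (relation "measure (\<lambda>(n, \<alpha>, i, P, Q, x). nat (\<alpha> n + 1 - i))") auto

text \<open>
  The number \<open>sum\<close> accumulates the contributions of all of \<open>x\<^sub>1, \<dots>, x\<^sub>l\<close>, so the new residues
  are obtained by subtracting it from the entries of the initial vector \<open>sol\<close>. Subtracting it
  from the entries of the argument \<open>S\<close>, which already account for \<open>x\<^sub>1, \<dots>, x\<^bsub>l-1\<^esub>\<close>, would
  count these contributions repeatedly, and the algorithm would then fail, for example, on
  \<open>{0, 1, 2, 5}\<close>.
\<close>

function fr_rec ::
  "nat \<Rightarrow> (nat \<Rightarrow> int) \<Rightarrow> int list \<Rightarrow> nat \<Rightarrow> int \<Rightarrow> int \<Rightarrow> (nat \<Rightarrow> int) \<Rightarrow> bool \<times> (nat \<Rightarrow> int)" where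
  "fr_rec n \<alpha> S l P Q x =
     (if n - 1 \<le> l then
        for_loop [0..fr_m n \<alpha> - 1]
          (\<lambda>i x. if S ! nat i = 0 then fr_end n \<alpha> i P Q x else (False, x)) x
      else
        for_loop [1..\<lfloor>cb P Q (\<alpha> l)\<rfloor>]
          (\<lambda>i x.
             let sum = (\<Sum>j = 1..l - 1. fr_g n \<alpha> j * x j) + fr_g n \<alpha> l * i;
                 S' = map (\<lambda>s. (s - sum) mod fr_m n \<alpha>) (fr_sol n \<alpha>)
             in if potential S' (fr_mu n \<alpha> (l + 1))
                then fr_rec n \<alpha> S' (l + 1) (P + i) (Q + i * \<alpha> l) (x(l := i))
                else (False, x)) x)"
  by pat_completeness auto
termination
  by (relation "measure (\<lambda>(n, \<alpha>, S, l, P, Q, x). n - l)") auto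

declare fr_end.simps [simp del] fr_rec.simps [simp del]

definition fast_reconstruction :: "nat \<Rightarrow> (nat \<Rightarrow> int) \<Rightarrow> (nat \<Rightarrow> int) \<Rightarrow> bool \<times> (nat \<Rightarrow> int)" where
  "fast_reconstruction n \<alpha> x = fr_rec n \<alpha> (fr_sol n \<alpha>) 1 0 0 x"

end

theory Submission
  imports Defs
begin

text \<open>
  By Landau's theorem, \<open>x\<close> is a correct score sequence iff, with \<open>P\<close> the number and \<open>Q\<close> the sum of
  the scores in the first \<open>l\<close> blocks, \<open>P (P - 1) / 2 \<le> Q\<close> for every \<open>l\<close>, with equality for \<open>l = n\<close>.
  If the first \<open>l - 1\<close> blocks satisfy this, the other root of the quadratic defining \<open>cb\<close> is not
  positive, so \<open>x\<^sub>l \<le> cb P Q \<alpha>\<^sub>l\<close> is exactly the inequality for block \<open>l\<close>, and equality of the two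
  sides is the final equality. Hence every answer of the search is correct.
  Conversely, the search cannot prune a correct \<open>x\<close>: writing the total number \<open>N\<close> of vertices as
  \<open>2 j\<close>, or as \<open>2 \<alpha>\<^sub>n + 1 - 2 j\<close> if it is odd, the final equality reads
  \<open>m x\<^bsub>n-1\<^esub> + \<Sum>i\<le>n-2. (\<alpha>\<^sub>n - \<alpha>\<^sub>i) x\<^sub>i = (2 \<alpha>\<^sub>n + 1 - 2 j) j\<close>,
  so the entry of the residue vector at \<open>j mod m\<close> survives every divisibility test.
\<close>

section \<open>Landau's theorem\<close>

lemma tournament_reverse_edge:
  assumes T: "tournament V T" and uv: "(u, v) \<in> T"
  defines "T' \<equiv> insert (v, u) (T - {(u, v)})"
  shows "tournament V T'"
    and "int (out_deg T' w) = int (out_deg T w) - of_bool (w = u) + of_bool (w = v)"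
proof -
  have V: "finite V" "T \<subseteq> V \<times> V" using T by (auto simp: tournament_def)
  have u: "u \<in> V" "v \<in> V" using uv V by auto
  have ne: "u \<noteq> v" using T uv u unfolding tournament_def by blast
  have vu: "(v, u) \<notin> T" using T uv u ne unfolding tournament_def by blast
  show "tournament V T'"
    using T u ne uv unfolding tournament_def T'_def by blast
  have fin: "finite {y. (a, y) \<in> T}" for a
    by (rule finite_subset[OF _ V(1)]) (use V(2) in auto)
  consider "w = u" | "w = v" | "w \<noteq> u" "w \<noteq> v" by blast
  then show "int (out_deg T' w) = int (out_deg T w) - of_bool (w = u) + of_bool (w = v)"
  proof cases
    case 1
    then have eq: "{y. (w, y) \<in> T} = insert v {y. (w, y) \<in> T'}" and nin: "v \<notin> {y. (w, y) \<in> T'}"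
      using uv ne by (auto simp: T'_def)
    moreover have "finite {y. (w, y) \<in> T'}"
      using fin[of w] unfolding eq by simp
    ultimately show ?thesis using 1 ne by (simp add: out_deg_def)
  next
    case 2
    then have "{y. (w, y) \<in> T'} = insert u {y. (w, y) \<in> T}" and "u \<notin> {y. (w, y) \<in> T}"
      using vu ne by (auto simp: T'_def)
    then show ?thesis using 2 ne fin[of w] by (simp add: out_deg_def)
  next
    case 3
    then have "{y. (w, y) \<in> T'} = {y. (w, y) \<in> T}" by (auto simp: T'_def)
    then show ?thesis using 3 by (simp add: out_deg_def)
  qed
qed

text \<open>Each inner vertex of the path loses one out-neighbour and gains another, so only the two
  ends change; for an empty \<open>p\<close> the two corrections cancel.\<close>

lemma tournament_reverse_path:
  assumes "tournament V T" "distinct (u # p)" "successively (\<lambda>a b. (a, b) \<in> T) (u # p)"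
  shows "\<exists>T'. tournament V T' \<and>
    (\<forall>w. int (out_deg T' w) = int (out_deg T w) - of_bool (w = u) + of_bool (w = last (u # p)))"
  using assms
proof (induction p arbitrary: u T)
  case Nil
  then show ?case by auto
next
  case (Cons v p)
  define T1 where "T1 = insert (v, u) (T - {(u, v)})"
  have uv: "(u, v) \<in> T" using Cons.prems by simp
  have T1: "tournament V T1"
    "\<And>w. int (out_deg T1 w) = int (out_deg T w) - of_bool (w = u) + of_bool (w = v)"
    using tournament_reverse_edge[OF Cons.prems(1) uv] by (simp_all add: T1_def)
  have "successively (\<lambda>a b. (a, b) \<in> T) (v # p)" using Cons.prems(3) by simp
  \<comment> \<open>Distinctness keeps \<open>u\<close> out of \<open>v # p\<close>, so reversing
    the first edge leaves the rest of the path intact.\<close>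
  then have "successively (\<lambda>a b. (a, b) \<in> T1) (v # p)"
    by (rule successively_mono) (use Cons.prems(2) in \<open>auto simp: T1_def\<close>)
  then obtain T' where "tournament V T'"
    "\<forall>w. int (out_deg T' w) = int (out_deg T1 w) - of_bool (w = v) + of_bool (w = last (v # p))"
    using Cons.IH[OF T1(1)] Cons.prems(2) by auto
  then show ?case using T1(2) by (intro exI[of _ T']) simp
qed

text \<open>If prepending \<open>u\<close> creates a repetition, the cycle is cut off by keeping
  only the suffix that starts at \<open>u\<close>.\<close>

lemma rtrancl_imp_distinct_path:
  assumes "(u, w) \<in> r\<^sup>*"
  shows "\<exists>p. distinct (u # p) \<and> successively (\<lambda>a b. (a, b) \<in> r) (u # p) \<and> last (u # p) = w"
  using assms
proof (induction rule: converse_rtrancl_induct)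
  case base
  show ?case by (intro exI[of _ "[]"]) simp
next
  case (step u v)
  then obtain p where p: "distinct (v # p)" "successively (\<lambda>a b. (a, b) \<in> r) (v # p)"
    "last (v # p) = w" by blast
  show ?case
  proof (cases "u \<in> set (v # p)")
    case True
    then obtain xs ys where eq: "v # p = xs @ u # ys" by (meson split_list)
    then have "distinct (u # ys)" "successively (\<lambda>a b. (a, b) \<in> r) (u # ys)" "last (u # ys) = w"
      using p by (auto simp del: successively.simps simp: successively_append_iff)
    then show ?thesis by blast
  next
    case False
    then show ?thesis using p step.hyps by (intro exI[of _ "v # p"]) auto
  qed
qed

section \<open>Counting edges inside a vertex set\<close>

lemma tournament_sum_edges_within:
  assumes T: "tournament V T" and "U \<subseteq> V"
  shows "2 * (\<Sum>u\<in>U. \<Sum>w\<in>U. of_bool ((u, w) \<in> T)) = int (card U) * (int (card U) - 1)"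
proof -
  have "finite U" using assms by (auto simp: tournament_def intro: finite_subset)
  then show ?thesis using assms(2)
  proof (induction U rule: finite_induct)
    case empty
    then show ?case by simp
  next
    case (insert x F)
    \<comment> \<open>The new vertex \<open>x\<close> is joined to each vertex of \<open>F\<close>
      by exactly one edge, in one of the two directions, which adds \<open>card F\<close>
      edges.\<close>
    have "(\<Sum>u\<in>F. of_bool ((u, x) \<in> T)) + (\<Sum>w\<in>F. of_bool ((x, w) \<in> T)) = (\<Sum>u\<in>F. (1::int))"
      unfolding sum.distrib[symmetric]
    proof (rule sum.cong[OF refl])
      fix u assume "u \<in> F"
      then have "u \<noteq> x" "u \<in> V" "x \<in> V" using insert by auto
      then have "(u, x) \<in> T \<longleftrightarrow> (x, u) \<notin> T" using T unfolding tournament_def by blast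
      then show "of_bool ((u, x) \<in> T) + of_bool ((x, u) \<in> T) = (1::int)" by simp
    qed
    moreover have "(x, x) \<notin> T" using T insert.prems by (simp add: tournament_def)
    moreover have "2 * (\<Sum>u\<in>F. \<Sum>w\<in>F. of_bool ((u, w) \<in> T)) = int (card F) * (int (card F) - 1)"
      using insert by simp
    ultimately show ?case
      using insert.hyps by (simp add: sum.distrib algebra_simps del: sum_of_bool_eq)
  qed
qed

lemma out_deg_within:
  assumes "{w. (v, w) \<in> T} \<subseteq> U" "finite U"
  shows "int (out_deg T v) = (\<Sum>w\<in>U. of_bool ((v, w) \<in> T))"
proof -
  have "{w. (v, w) \<in> T} = U \<inter> {w. (v, w) \<in> T}" using assms by auto
  then show ?thesis using assms(2) by (simp add: out_deg_def of_bool_def sum.If_cases)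
qed

text \<open>With no edge leaving \<open>U\<close>, out-degrees count only edges inside
  \<open>U\<close>. This serves both for \<open>V\<close> itself and for sets of reachable
  vertices.\<close>

lemma tournament_sum_out_deg_closed:
  assumes T: "tournament V T" and U: "U \<subseteq> V" and cl: "\<And>u w. u \<in> U \<Longrightarrow> (u, w) \<in> T \<Longrightarrow> w \<in> U"
  shows "2 * (\<Sum>u\<in>U. int (out_deg T u)) = int (card U) * (int (card U) - 1)"
proof -
  have "finite U" using T U by (auto simp: tournament_def intro: finite_subset)
  then have "(\<Sum>u\<in>U. int (out_deg T u)) = (\<Sum>u\<in>U. \<Sum>w\<in>U. of_bool ((u, w) \<in> T))"
    by (intro sum.cong refl out_deg_within) (use cl in auto)
  then show ?thesis using tournament_sum_edges_within[OF T U] by simp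
qed

text \<open>The necessity half of Landau's theorem: the edges inside \<open>U\<close> already give
  the lower bound, and edges leaving \<open>U\<close> only add to it.\<close>

lemma tournament_sum_out_deg_ge:
  assumes T: "tournament V T" and U: "U \<subseteq> V"
  shows "int (card U) * (int (card U) - 1) \<le> 2 * (\<Sum>u\<in>U. int (out_deg T u))"
proof -
  have fin: "finite V" and TV: "T \<subseteq> V \<times> V" using T by (auto simp: tournament_def)
  have "(\<Sum>u\<in>U. \<Sum>w\<in>U. of_bool ((u, w) \<in> T)) \<le> (\<Sum>u\<in>U. \<Sum>w\<in>V. of_bool ((u, w) \<in> T) :: int)"
    by (intro sum_mono sum_mono2 fin U) auto
  also have "\<dots> = (\<Sum>u\<in>U. int (out_deg T u))"
    by (intro sum.cong refl out_deg_within[symmetric] fin) (use TV in auto)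
  finally show ?thesis using tournament_sum_edges_within[OF T U] by simp
qed

text \<open>
  Landau's theorem. Among all tournaments take one whose out-degrees are closest to \<open>s\<close>. If some
  vertex exceeds its prescribed score, the set of vertices reachable from such vertices is closed
  under out-neighbours, so Landau's inequality puts a vertex with a deficit into it, and reversing
  a path to that vertex contradicts minimality.
\<close>

theorem landau_tournament_exists:
  fixes V :: "'v set" and s :: "'v \<Rightarrow> int"
  assumes fin: "finite V"
    and landau: "\<And>U. U \<subseteq> V \<Longrightarrow> int (card U) * (int (card U) - 1) \<le> 2 * (\<Sum>u\<in>U. s u)"
    and total: "int (card V) * (int (card V) - 1) = 2 * (\<Sum>u\<in>V. s u)"
  shows "\<exists>T. tournament V T \<and> (\<forall>v\<in>V. int (out_deg T v) = s v)"
proof -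
  define err where "err T = (\<Sum>v\<in>V. nat \<bar>int (out_deg T v) - s v\<bar>)" for T
  have "\<exists>T. tournament V T"
  proof -
    \<comment> \<open>The minimisation starts from a transitive tournament, ordered by an injection
      into the naturals.\<close>
    obtain f :: "'v \<Rightarrow> nat" where "inj_on f V"
      using fin finite_imp_inj_to_nat_seg by blast
    then show ?thesis
      by (intro exI[of _ "{(u, v). u \<in> V \<and> v \<in> V \<and> f u < f v}"])
        (auto simp: tournament_def fin inj_on_eq_iff not_less less_le)
  qed
  then obtain T where T: "tournament V T" and least: "\<And>T'. tournament V T' \<Longrightarrow> err T \<le> err T'"
    using ex_has_least_nat[of "tournament V" _ err] by blast
  have TV: "T \<subseteq> V \<times> V" using T by (simp add: tournament_def)
  have le: "int (out_deg T u) \<le> s u" if u: "u \<in> V" for u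
  proof (rule ccontr)
    assume exceeds: "\<not> int (out_deg T u) \<le> s u"
    define R where "R = {w. (u, w) \<in> T\<^sup>*}"
    have RV: "R \<subseteq> V"
    proof
      fix w assume "w \<in> R"
      then have "(u, w) \<in> T\<^sup>*" by (simp add: R_def)
      then show "w \<in> V" by (induction rule: rtrancl_induct) (use u TV in auto)
    qed
    have finR: "finite R" using RV fin finite_subset by blast
    have "2 * (\<Sum>u\<in>R. int (out_deg T u)) = int (card R) * (int (card R) - 1)"
      by (rule tournament_sum_out_deg_closed[OF T RV]) (auto simp: R_def)
    then have "(\<Sum>u\<in>R. int (out_deg T u)) \<le> (\<Sum>u\<in>R. s u)" using landau[OF RV] by simp
    moreover have "u \<in> R" by (simp add: R_def)
    ultimately have "\<exists>w\<in>R. int (out_deg T w) < s w"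
      using sum_strict_mono_ex1[OF finR, of s "\<lambda>u. int (out_deg T u)"] exceeds by force
    then obtain w where w: "(u, w) \<in> T\<^sup>*" "w \<in> V" "int (out_deg T w) < s w"
      using RV by (auto simp: R_def)
    obtain T' where T': "tournament V T'"
      "\<And>v. int (out_deg T' v) = int (out_deg T v) - of_bool (v = u) + of_bool (v = w)"
      using rtrancl_imp_distinct_path[OF w(1)] tournament_reverse_path[OF T] by metis
    \<comment> \<open>One unit of out-degree moves from \<open>u\<close>, which has too much, to
      \<open>w\<close>, which has too little, so the error drops at both and is unchanged
      elsewhere.\<close>
    have "err T' < err T"
      unfolding err_def
    proof (rule sum_strict_mono_ex1[OF fin])
      show "\<forall>v\<in>V. nat \<bar>int (out_deg T' v) - s v\<bar> \<le> nat \<bar>int (out_deg T v) - s v\<bar>"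
        using exceeds w(3) by (auto simp: T'(2))
      show "\<exists>v\<in>V. nat \<bar>int (out_deg T' v) - s v\<bar> < nat \<bar>int (out_deg T v) - s v\<bar>"
        using exceeds w(3) u by (intro bexI[of _ u]) (auto simp: T'(2))
    qed
    then show False using least[OF T'(1)] by simp
  qed
  have "2 * (\<Sum>u\<in>V. int (out_deg T u)) = int (card V) * (int (card V) - 1)"
    by (rule tournament_sum_out_deg_closed[OF T]) (use TV in auto)
  then have "(\<Sum>u\<in>V. int (out_deg T u)) = (\<Sum>u\<in>V. s u)" using total by simp
  then have "\<forall>v\<in>V. int (out_deg T v) = s v"
    using sum_strict_mono_ex1[OF fin, of "\<lambda>u. int (out_deg T u)" s] le by force
  then show ?thesis using T by blast
qed

section \<open>Landau's theorem for sequences with repeated scores\<close>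

text \<open>Landau's condition is imposed at block ends only, doubled to stay in the integers;
  \<open>landau_between\<close> recovers it inside the blocks.\<close>

definition landau_blocks :: "nat \<Rightarrow> (nat \<Rightarrow> int) \<Rightarrow> (nat \<Rightarrow> int) \<Rightarrow> bool" where
  "landau_blocks l \<alpha> x \<longleftrightarrow>
     (\<forall>i\<in>{1..l}. 1 \<le> x i \<and> (sum x {1..i}) * (sum x {1..i} - 1) \<le> 2 * (\<Sum>j = 1..i. x j * \<alpha> j))"

definition landau_exact :: "nat \<Rightarrow> (nat \<Rightarrow> int) \<Rightarrow> (nat \<Rightarrow> int) \<Rightarrow> bool" where
  "landau_exact n \<alpha> x \<longleftrightarrow>
     landau_blocks n \<alpha> x \<and> sum x {1..n} * (sum x {1..n} - 1) = 2 * (\<Sum>j = 1..n. x j * \<alpha> j)"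

section \<open>Sums over a sequence made of blocks\<close>

lemma sum_list_concat_replicate:
  fixes f :: "int \<Rightarrow> int"
  assumes "\<forall>i\<in>{1..n}. x i \<ge> 0"
  shows "sum_list (map f (concat (map (\<lambda>i. replicate (nat (x i)) (\<alpha> i)) [1..<Suc n])))
    = (\<Sum>i = 1..n. x i * f (\<alpha> i))"
  using assms
proof (induction n)
  case (Suc n)
  then show ?case by (auto simp: sum_list_replicate)
qed simp

lemma sorted_concat_replicate:
  fixes \<alpha> :: "nat \<Rightarrow> int"
  assumes "strict_mono_on {1..n} \<alpha>"
  shows "sorted (concat (map (\<lambda>i. replicate (nat (x i)) (\<alpha> i)) [1..<Suc n]))"
  using assms
proof (induction n)
  case (Suc n)
  have "strict_mono_on {1..n} \<alpha>"
    using Suc.prems by (auto simp: strict_mono_on_def)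
  moreover have "\<alpha> i \<le> \<alpha> (Suc n)" if "1 \<le> i" "i \<le> n" for i
    using strict_mono_onD[OF Suc.prems, of i "Suc n"] that by simp
  ultimately show ?case using Suc.IH
    by (auto simp: sorted_append sorted_replicate)
qed simp

text \<open>Used with \<open>f\<close> constantly 1 or the identity, and with both cut off above a
  threshold, to obtain numbers and sums of scores.\<close>

lemma sum_out_deg_score_sequence:
  fixes f :: "int \<Rightarrow> int"
  assumes "finite V" "\<forall>i\<in>{1..n}. x i \<ge> 0"
    and "map int (score_sequence V T) = concat (map (\<lambda>i. replicate (nat (x i)) (\<alpha> i)) [1..<Suc n])"
  shows "(\<Sum>v\<in>V. f (int (out_deg T v))) = (\<Sum>i = 1..n. x i * f (\<alpha> i))"
proof -
  have "(\<Sum>v\<in>V. f (int (out_deg T v))) = sum_mset (image_mset (f \<circ> int) (mset (score_sequence V T)))"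
    by (simp add: score_sequence_def sum_unfold_sum_mset image_mset.compositionality comp_def)
  also have "\<dots> = sum_list (map f (map int (score_sequence V T)))"
    by (simp flip: sum_mset_sum_list add: image_mset.compositionality)
  also have "\<dots> = (\<Sum>i = 1..n. x i * f (\<alpha> i))"
    unfolding assms(3) by (rule sum_list_concat_replicate[OF assms(2)])
  finally show ?thesis .
qed

lemma sum_blocks_below:
  fixes \<alpha> :: "nat \<Rightarrow> int"
  assumes "strict_mono_on {1..n} \<alpha>" "l \<in> {1..n}"
  shows "(\<Sum>i = 1..n. if \<alpha> i \<le> \<alpha> l then h i else 0) = (\<Sum>i = 1..l. h i :: int)"
proof -
  have "(\<Sum>i = 1..n. if \<alpha> i \<le> \<alpha> l then h i else 0) = sum h ({1..n} \<inter> {i. \<alpha> i \<le> \<alpha> l})"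
    by (simp add: sum.If_cases)
  also have "{1..n} \<inter> {i. \<alpha> i \<le> \<alpha> l} = {1..l}"
  proof -
    have "\<alpha> i \<le> \<alpha> l \<longleftrightarrow> i \<le> l" if "i \<in> {1..n}" for i
      using strict_mono_onD[OF assms(1) that assms(2)] strict_mono_onD[OF assms(1) assms(2) that]
      by (cases i l rule: linorder_cases) auto
    then show ?thesis using assms(2) by auto
  qed
  finally show ?thesis .
qed

lemma correct_score_sequence_imp_landau_exact:
  assumes mono: "strict_mono_on {1..n} \<alpha>" and cor: "correct_score_sequence n \<alpha> x"
  shows "landau_exact n \<alpha> x"
proof -
  obtain V :: "nat set" and T where T: "tournament V T"
    and sc: "map int (score_sequence V T) = concat (map (\<lambda>i. replicate (nat (x i)) (\<alpha> i)) [1..<Suc n])"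
    using cor by (auto simp: correct_score_sequence_def)
  have pos: "\<forall>i\<in>{1..n}. x i \<ge> 1" using cor by (simp add: correct_score_sequence_def)
  then have nonneg: "\<forall>i\<in>{1..n}. x i \<ge> 0" by force
  have fin: "finite V" and TV: "T \<subseteq> V \<times> V" using T by (simp_all add: tournament_def)
  note cnt = sum_out_deg_score_sequence[OF fin nonneg sc]
  have "landau_blocks n \<alpha> x"
    unfolding landau_blocks_def
  proof (intro ballI conjI)
    fix l assume l: "l \<in> {1..n}"
    show "1 \<le> x l" using pos l by simp
    \<comment> \<open>These are the vertices of the first \<open>l\<close> blocks, so the inequality
      for \<open>U\<close> is the one for block \<open>l\<close>.\<close>
    define U where "U = V \<inter> {v. int (out_deg T v) \<le> \<alpha> l}"
    have "int (card U) = (\<Sum>v\<in>V. if int (out_deg T v) \<le> \<alpha> l then 1 else 0)"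
      using fin by (simp add: U_def sum.If_cases)
    also have "\<dots> = (\<Sum>i = 1..n. if \<alpha> i \<le> \<alpha> l then x i else 0)"
      unfolding cnt[of "\<lambda>a. if a \<le> \<alpha> l then 1 else 0"] by (intro sum.cong) auto
    finally have card: "int (card U) = sum x {1..l}"
      using sum_blocks_below[OF mono l] by simp
    have "(\<Sum>v\<in>U. int (out_deg T v)) = (\<Sum>v\<in>V. if int (out_deg T v) \<le> \<alpha> l then int (out_deg T v) else 0)"
      using fin by (simp add: U_def sum.If_cases)
    also have "\<dots> = (\<Sum>i = 1..n. if \<alpha> i \<le> \<alpha> l then x i * \<alpha> i else 0)"
      unfolding cnt[of "\<lambda>a. if a \<le> \<alpha> l then a else 0"] by (intro sum.cong) auto
    finally have "(\<Sum>v\<in>U. int (out_deg T v)) = (\<Sum>i = 1..l. x i * \<alpha> i)"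
      using sum_blocks_below[OF mono l] by simp
    then show "(sum x {1..l}) * (sum x {1..l} - 1) \<le> 2 * (\<Sum>j = 1..l. x j * \<alpha> j)"
      using tournament_sum_out_deg_ge[OF T, of U] card by (simp add: U_def)
  qed
  moreover have "2 * (\<Sum>v\<in>V. int (out_deg T v)) = int (card V) * (int (card V) - 1)"
    by (rule tournament_sum_out_deg_closed[OF T]) (use TV in auto)
  then have "sum x {1..n} * (sum x {1..n} - 1) = 2 * (\<Sum>j = 1..n. x j * \<alpha> j)"
    using cnt[of "\<lambda>_. 1"] cnt[of "\<lambda>a. a"] by simp
  ultimately show ?thesis by (simp add: landau_exact_def)
qed

text \<open>
  The Landau defect is a concave function of the number of vertices taken from one block, hence it
  is nonnegative on the block as soon as it is at both ends.
\<close>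

lemma landau_between:
  fixes P Q a x t :: int
  assumes "P * (P - 1) \<le> 2 * Q" "(P + x) * (P + x - 1) \<le> 2 * (Q + x * a)" "0 \<le> t" "t \<le> x"
  shows "(P + t) * (P + t - 1) \<le> 2 * (Q + t * a)"
proof (cases "x = 0")
  case True
  then show ?thesis using assms by simp
next
  case False
  then have x: "x > 0" using assms by simp
  \<comment> \<open>Interpolation between the defects at the two ends, scaled by \<open>x\<close>;
    the last summand is the gain from concavity.\<close>
  have "0 \<le> (x - t) * (2 * Q - P * (P - 1)) + t * (2 * (Q + x * a) - (P + x) * (P + x - 1))
      + t * (x * (x - t))"
    using assms by (intro add_nonneg_nonneg mult_nonneg_nonneg) auto
  also have "\<dots> = x * (2 * (Q + t * a) - (P + t) * (P + t - 1))"
    by (simp add: algebra_simps)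
  finally show ?thesis using x by (simp add: zero_le_mult_iff)
qed

lemma exists_block:
  fixes x :: "nat \<Rightarrow> int"
  assumes "0 \<le> k" "k \<le> sum x {1..n}" "n \<ge> 1"
  shows "\<exists>l\<in>{1..n}. sum x {1..l - 1} \<le> k \<and> k \<le> sum x {1..l}"
  using assms(3,2)
proof (induction n rule: nat_induct_at_least)
  case base
  then show ?case using assms(1) by auto
next
  case (Suc n)
  show ?case
  proof (cases "k \<le> sum x {1..n}")
    case True
    then show ?thesis using Suc.IH by fastforce
  next
    case False
    then show ?thesis using Suc.prems by (intro bexI[of _ "Suc n"]) auto
  qed
qed

text \<open>Positions in the list \<open>L\<close> serve as vertices. A set of \<open>k\<close> of
  them has score sum at least that of the \<open>k\<close> smallest scores, and for these
  \<open>landau_between\<close> gives Landau's inequality.\<close>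

lemma landau_exact_imp_correct_score_sequence:
  assumes mono: "strict_mono_on {1..n} \<alpha>" and n: "n \<ge> 1" and exact: "landau_exact n \<alpha> x"
  shows "correct_score_sequence n \<alpha> x"
proof -
  have blocks: "landau_blocks n \<alpha> x"
    and total: "sum x {1..n} * (sum x {1..n} - 1) = 2 * (\<Sum>j = 1..n. x j * \<alpha> j)"
    using exact by (simp_all add: landau_exact_def)
  define L where "L = concat (map (\<lambda>i. replicate (nat (x i)) (\<alpha> i)) [1..<Suc n])"
  define V where "V = {..<length L}"
  have pos: "\<forall>i\<in>{1..n}. x i \<ge> 1" using blocks by (simp add: landau_blocks_def)
  then have nonneg: "\<forall>i\<in>{1..n}. x i \<ge> 0" by force
  have cnt: "(\<Sum>v\<in>V. f (L ! v)) = (\<Sum>i = 1..n. x i * f (\<alpha> i))" for f :: "int \<Rightarrow> int"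
    using sum_list_concat_replicate[OF nonneg, of f \<alpha>]
    unfolding L_def[symmetric] by (simp add: sum_list_sum_nth V_def atLeast0LessThan)
  have cardV: "int (card V) = sum x {1..n}" using cnt[of "\<lambda>_. 1"] by simp
  have "\<exists>T. tournament V T \<and> (\<forall>v\<in>V. int (out_deg T v) = L ! v)"
  proof (rule landau_tournament_exists)
    show "finite V" by (simp add: V_def)
    show "int (card V) * (int (card V) - 1) = 2 * (\<Sum>u\<in>V. L ! u)"
      using total cnt[of "\<lambda>a. a"] by (simp add: cardV)
    fix U assume U: "U \<subseteq> V"
    define k where "k = int (card U)"
    have "k \<le> sum x {1..n}"
      using card_mono[OF \<open>finite V\<close> U] cardV by (simp add: k_def)
    then obtain l where l: "l \<in> {1..n}" "sum x {1..l - 1} \<le> k" "k \<le> sum x {1..l}"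
      using exists_block[of k x n] n by (auto simp: k_def)
    define P Q where "P = sum x {1..l - 1}" and "Q = (\<Sum>j = 1..l - 1. x j * \<alpha> j)"
    have P': "sum x {1..l} = P + x l" and Q': "(\<Sum>j = 1..l. x j * \<alpha> j) = Q + x l * \<alpha> l"
      using l(1) by (cases l; simp add: P_def Q_def)+
    have "P * (P - 1) \<le> 2 * Q"
    proof (cases "l = 1")
      case True
      then show ?thesis by (simp add: P_def Q_def)
    next
      case False
      then have "l - 1 \<in> {1..n}" using l(1) by auto
      then show ?thesis using blocks unfolding landau_blocks_def P_def Q_def by blast
    qed
    moreover have "(P + x l) * (P + x l - 1) \<le> 2 * (Q + x l * \<alpha> l)"
      using blocks l(1) unfolding landau_blocks_def P'[symmetric] Q'[symmetric] by blast
    ultimately have "(P + (k - P)) * (P + (k - P) - 1) \<le> 2 * (Q + (k - P) * \<alpha> l)"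
      by (rule landau_between) (use l P' in \<open>auto simp: P_def\<close>)
    \<comment> \<open>Comparison with the \<open>k\<close> smallest scores: once
      \<open>\<alpha> l\<close> is subtracted from every score, the negative parts total
      \<open>Q - P * \<alpha> l\<close> (block \<open>l\<close> contributes 0), and restricting to
      \<open>U\<close> drops only nonpositive terms.\<close>
    moreover have "Q + (k - P) * \<alpha> l \<le> (\<Sum>u\<in>U. L ! u)"
    proof -
      have "Q - P * \<alpha> l = (\<Sum>j = 1..l. x j * (\<alpha> j - \<alpha> l))"
        using P' Q' by (simp add: right_diff_distrib sum_subtractf flip: sum_distrib_right)
          (simp add: algebra_simps)
      also have "\<dots> = (\<Sum>i = 1..n. if \<alpha> i \<le> \<alpha> l then x i * (\<alpha> i - \<alpha> l) else 0)"
        using sum_blocks_below[OF mono l(1)] by simp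
      also have "\<dots> = (\<Sum>i = 1..n. x i * min 0 (\<alpha> i - \<alpha> l))"
        by (intro sum.cong) auto
      also have "\<dots> = (\<Sum>v\<in>V. min 0 (L ! v - \<alpha> l))"
        using cnt[of "\<lambda>a. min 0 (a - \<alpha> l)"] by simp
      also have "\<dots> \<le> (\<Sum>v\<in>U. min 0 (L ! v - \<alpha> l))"
        using sum_mono2[OF \<open>finite V\<close> U, of "\<lambda>v. - min 0 (L ! v - \<alpha> l)"]
        by (simp add: sum_negf)
      also have "\<dots> \<le> (\<Sum>v\<in>U. L ! v - \<alpha> l)" by (intro sum_mono) simp
      also have "\<dots> = (\<Sum>v\<in>U. L ! v) - k * \<alpha> l" by (simp add: sum_subtractf k_def)
      finally show ?thesis by (simp add: algebra_simps)
    qed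
    ultimately show "int (card U) * (int (card U) - 1) \<le> 2 * (\<Sum>u\<in>U. L ! u)"
      by (simp add: k_def)
  qed
  then obtain T where T: "tournament V T" and deg: "\<And>v. v < length L \<Longrightarrow> int (out_deg T v) = L ! v"
    by (auto simp: V_def)
  have L: "map int (map (out_deg T) [0..<length L]) = L"
    by (rule nth_equalityI) (simp_all add: deg)
  \<comment> \<open>Block values increase, so the out-degrees listed by vertex number already form
    the sorted score sequence.\<close>
  have "sorted (map int (map (out_deg T) [0..<length L]))"
    unfolding L using sorted_concat_replicate[OF mono] by (simp add: L_def)
  then have "sorted (map (out_deg T) [0..<length L])"
    by (simp add: sorted_iff_nth_mono)
  moreover have "image_mset (out_deg T) (mset_set V) = mset (map (out_deg T) [0..<length L])"
    by (simp add: V_def atLeast0LessThan)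
  ultimately have "score_sequence V T = map (out_deg T) [0..<length L]"
    unfolding score_sequence_def by (simp only: sorted_list_of_multiset_mset sorted_sort_id)
  then have "map int (score_sequence V T) = L" using L by simp
  then show ?thesis using T pos unfolding correct_score_sequence_def L_def by blast
qed

section \<open>Correctness of the search\<close>

lemma cb_eq_larger_root:
  fixes P Q a t :: real
  assumes C: "P * (P - 1) \<le> 2 * Q" and t: "0 < t"
  shows "t \<le> cb P Q a \<longleftrightarrow> (P + t) * (P + t - 1) \<le> 2 * (Q + t * a)"
    and "t = cb P Q a \<longleftrightarrow> (P + t) * (P + t - 1) = 2 * (Q + t * a)"
proof -
  define B where "B = 2 * (a - P) + 1"
  define D where "D = sqrt (B\<^sup>2 + 8 * (Q - P * (P - 1) / 2))"
  have cb: "cb P Q a = (B + D) / 2" by (simp add: cb_def B_def D_def)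
  have "0 \<le> B\<^sup>2 + 8 * (Q - P * (P - 1) / 2)" using C by simp
  then have D2: "D\<^sup>2 = B\<^sup>2 + 8 * (Q - P * (P - 1) / 2)" by (simp add: D_def)
  \<comment> \<open>This makes the smaller root \<open>(B - D) / 2\<close> nonpositive, so for
    positive \<open>t\<close> the sign of the quadratic is that of
    \<open>t - cb P Q a\<close>.\<close>
  have "\<bar>B\<bar> \<le> D"
    unfolding D_def by (intro real_le_rsqrt) (use C in simp)
  then have pos: "0 < t - (B - D) / 2" using t by simp
  have "(t - cb P Q a) * (t - (B - D) / 2) = t\<^sup>2 - B * t + (B\<^sup>2 - D\<^sup>2) / 4"
    by (simp add: cb power2_eq_square field_simps)
  also have "\<dots> = (P + t) * (P + t - 1) - 2 * (Q + t * a)"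
    unfolding D2 by (simp add: B_def power2_eq_square field_simps)
  finally have eq: "(P + t) * (P + t - 1) - 2 * (Q + t * a) = (t - cb P Q a) * (t - (B - D) / 2)" ..
  show "t \<le> cb P Q a \<longleftrightarrow> (P + t) * (P + t - 1) \<le> 2 * (Q + t * a)"
    using eq pos mult_le_0_iff[of "t - cb P Q a" "t - (B - D) / 2"] by auto
  show "t = cb P Q a \<longleftrightarrow> (P + t) * (P + t - 1) = 2 * (Q + t * a)"
    using eq pos mult_eq_0_iff[of "t - cb P Q a" "t - (B - D) / 2"] by auto
qed

lemma int_cb_iff:
  fixes P Q a t :: int
  assumes "P * (P - 1) \<le> 2 * Q" and "1 \<le> t"
  shows "real_of_int t \<le> cb P Q a \<longleftrightarrow> (P + t) * (P + t - 1) \<le> 2 * (Q + t * a)"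
    and "real_of_int t = cb P Q a \<longleftrightarrow> (P + t) * (P + t - 1) = 2 * (Q + t * a)"
proof -
  have "real_of_int (P * (P - 1)) \<le> real_of_int (2 * Q)" using assms(1) by (simp only: of_int_le_iff)
  then have C: "real_of_int P * (real_of_int P - 1) \<le> 2 * real_of_int Q" by simp
  have t: "0 < real_of_int t" using assms(2) by simp
  have "real_of_int t \<le> cb P Q a \<longleftrightarrow>
      real_of_int ((P + t) * (P + t - 1)) \<le> real_of_int (2 * (Q + t * a))"
    using cb_eq_larger_root(1)[OF C t, of a] by simp
  then show "real_of_int t \<le> cb P Q a \<longleftrightarrow> (P + t) * (P + t - 1) \<le> 2 * (Q + t * a)"
    by (simp only: of_int_le_iff)
  have "real_of_int t = cb P Q a \<longleftrightarrow>
      real_of_int ((P + t) * (P + t - 1)) = real_of_int (2 * (Q + t * a))"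
    using cb_eq_larger_root(2)[OF C t, of a] by simp
  then show "real_of_int t = cb P Q a \<longleftrightarrow> (P + t) * (P + t - 1) = 2 * (Q + t * a)"
    by (simp only: of_int_eq_iff)
qed

lemma landau_blocks_0 [simp]: "landau_blocks 0 \<alpha> x"
  by (simp add: landau_blocks_def)

lemma landau_blocks_prefix:
  "landau_blocks l \<alpha> x \<Longrightarrow> k \<le> l \<Longrightarrow> landau_blocks k \<alpha> x"
  by (auto simp: landau_blocks_def)

lemma landau_blocks_sum_le:
  assumes "landau_blocks l \<alpha> x"
  shows "sum x {1..l} * (sum x {1..l} - 1) \<le> 2 * (\<Sum>j = 1..l. x j * \<alpha> j)"
proof (cases "l = 0")
  case False
  then have "l \<in> {1..l}" by simp
  then show ?thesis using assms unfolding landau_blocks_def by blast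
qed simp

text \<open>Landau's inequality for the first \<open>l\<close> blocks is what
  \<open>int_cb_iff\<close> asks for, so the loop bound of the search admits exactly the right
  values for the next block.\<close>

lemma landau_blocks_Suc:
  "landau_blocks (Suc l) \<alpha> x \<longleftrightarrow> landau_blocks l \<alpha> x \<and> 1 \<le> x (Suc l) \<and>
     real_of_int (x (Suc l)) \<le> cb (sum x {1..l}) (\<Sum>j = 1..l. x j * \<alpha> j) (\<alpha> (Suc l))"
proof -
  have "landau_blocks (Suc l) \<alpha> x \<longleftrightarrow> landau_blocks l \<alpha> x \<and> 1 \<le> x (Suc l) \<and>
     (sum x {1..l} + x (Suc l)) * (sum x {1..l} + x (Suc l) - 1)
       \<le> 2 * ((\<Sum>j = 1..l. x j * \<alpha> j) + x (Suc l) * \<alpha> (Suc l))"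
    by (auto simp: landau_blocks_def atLeastAtMostSuc_conv ac_simps)
  then show ?thesis
    using int_cb_iff(1)[OF landau_blocks_sum_le] by blast
qed

lemma landau_blocks_cong:
  assumes "\<And>j. j \<in> {1..l} \<Longrightarrow> x j = y j"
  shows "landau_blocks l \<alpha> x \<longleftrightarrow> landau_blocks l \<alpha> y"
proof -
  have "sum x {1..i} = sum y {1..i}" "(\<Sum>j = 1..i. x j * \<alpha> j) = (\<Sum>j = 1..i. y j * \<alpha> j)"
    if "i \<in> {1..l}" for i
    by (intro sum.cong refl; use assms that in simp)+
  then show ?thesis using assms unfolding landau_blocks_def by (intro ball_cong refl) auto
qed

section \<open>Loops that stop at the first success\<close>

lemma for_loop_invariant:
  assumes "I x" "\<And>i y. i \<in> set is \<Longrightarrow> I y \<Longrightarrow> I (snd (body i y))"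
  shows "I (snd (for_loop is body x))"
  using assms
proof (induction "is" arbitrary: x)
  case (Cons i "is")
  have "I (snd (body i x))" using Cons.prems by simp
  then show ?case using Cons by (auto simp: case_prod_beta)
qed simp

text \<open>A failed iteration may leave altered variables behind, so the successful one is analysed
  from an arbitrary state satisfying \<open>I\<close>.\<close>

lemma for_loop_sound:
  assumes "fst (for_loop is body x)" "I x"
    and "\<And>i y. i \<in> set is \<Longrightarrow> I y \<Longrightarrow> I (snd (body i y))"
    and "\<And>i y. i \<in> set is \<Longrightarrow> I y \<Longrightarrow> fst (body i y) \<Longrightarrow> R (snd (body i y))"
  shows "R (snd (for_loop is body x))"
  using assms
proof (induction "is" arbitrary: x)
  case (Cons i "is")
  then show ?case by (cases "body i x"; cases "fst (body i x)") fastforce+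
qed simp

text \<open>Iterations before the one for \<open>i\<^sub>0\<close> either succeed themselves or hand
  on a state satisfying \<open>I\<close>.\<close>

lemma for_loop_complete:
  assumes "i\<^sub>0 \<in> set is" "I x"
    and "\<And>i y. i \<in> set is \<Longrightarrow> I y \<Longrightarrow> I (snd (body i y))"
    and "\<And>y. I y \<Longrightarrow> fst (body i\<^sub>0 y)"
  shows "fst (for_loop is body x)"
  using assms
proof (induction "is" arbitrary: x)
  case (Cons i "is")
  obtain b y where b: "body i x = (b, y)" by fastforce
  show ?case
  proof (cases b)
    case False
    have "i\<^sub>0 \<noteq> i" using Cons.prems(2,4) b False by force
    moreover have "I y" using Cons.prems(2) Cons.prems(3)[of i x] b by simp
    ultimately have "fst (for_loop is body y)" using Cons by simp
    then show ?thesis using b False by simp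
  qed (simp add: b)
qed simp

section \<open>Choosing the last two block lengths\<close>

lemma fr_end_frame: "j < n - 1 \<Longrightarrow> snd (fr_end n \<alpha> i P Q x) j = x j"
proof (induction n \<alpha> i P Q x rule: fr_end.induct)
  case (1 n \<alpha> i P Q x)
  then show ?case by (subst fr_end.simps) (auto simp: Let_def)
qed

text \<open>The acceptance test contains the required bounds, and integrality of \<open>t1\<close>
  and \<open>t2\<close> makes the stored floors exact.\<close>

lemma fr_end_sound:
  assumes "fst (fr_end n \<alpha> i P Q x)" "n \<ge> 2"
  defines "y \<equiv> snd (fr_end n \<alpha> i P Q x)"
  shows "1 \<le> y (n - 1) \<and> real_of_int (y (n - 1)) \<le> cb P Q (\<alpha> (n - 1)) \<and> 1 \<le> y n \<and>
    real_of_int (y n) = cb (P + y (n - 1)) (Q + y (n - 1) * \<alpha> (n - 1)) (\<alpha> n)"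
  using assms(1,2) unfolding y_def
proof (induction n \<alpha> i P Q x rule: fr_end.induct)
  case (1 n \<alpha> i P Q x)
  define t1 where "t1 = real_of_int ((2 * \<alpha> n + 1 - 2 * i) * i - P * \<alpha> n + Q) / real_of_int (fr_m n \<alpha>)"
  define t2 where "t2 = cb (P + t1) (Q + t1 * \<alpha> (n - 1)) (\<alpha> n)"
  note simps = fr_end.simps[of n \<alpha> i P Q x, folded t1_def, unfolded Let_def, folded t2_def]
  have guard: "0 < fr_m n \<alpha> \<and> real_of_int i \<le> (2 * real_of_int (\<alpha> n) + 1) / 2"
    using "1.prems"(1) by (subst (asm) simps) (auto split: if_splits)
  show ?case
  proof (cases "t1 \<in> \<int> \<and> 1 \<le> t1 \<and> t1 \<le> cb P Q (\<alpha> (n - 1)) \<and> t2 \<in> \<int> \<and> 1 \<le> t2")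
    case True
    then have res: "fr_end n \<alpha> i P Q x = (True, x(n := \<lfloor>t2\<rfloor>, n - 1 := \<lfloor>t1\<rfloor>))"
      using guard simps by simp
    have n_ne: "n \<noteq> n - 1" using \<open>n \<ge> 2\<close> by simp
    have "real_of_int \<lfloor>t1\<rfloor> = t1" "real_of_int \<lfloor>t2\<rfloor> = t2" using True by simp_all
    then show ?thesis using True \<open>n \<ge> 2\<close> n_ne unfolding res by (simp add: t2_def)
  next
    case False
    then have res: "fr_end n \<alpha> i P Q x = fr_end n \<alpha> (i + fr_m n \<alpha>) P Q x"
      using guard simps by auto
    show ?thesis
      using "1.IH"[OF guard refl refl] "1.prems" False unfolding t2_def t1_def res by blast
  qed
qed

text \<open>Unless an earlier round succeeds, the loop reaches \<open>j\<close> after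
  \<open>k\<close> increments, and there the two candidates are \<open>t\<close> and
  \<open>u\<close>.\<close>

lemma fr_end_complete:
  fixes k :: nat and t u :: int
  assumes m: "0 < fr_m n \<alpha>" and "j = i + int k * fr_m n \<alpha>" "2 * j \<le> 2 * \<alpha> n + 1"
    and t: "t * fr_m n \<alpha> = (2 * \<alpha> n + 1 - 2 * j) * j - P * \<alpha> n + Q"
      "1 \<le> t" "real_of_int t \<le> cb P Q (\<alpha> (n - 1))"
    and u: "1 \<le> u" "real_of_int u = cb (P + t) (Q + t * \<alpha> (n - 1)) (\<alpha> n)"
  shows "fst (fr_end n \<alpha> i P Q x)"
  using assms(2,3)
proof (induction k arbitrary: i)
  case 0
  then have j: "i = j" by simp
  have "real_of_int (2 * j) \<le> real_of_int (2 * \<alpha> n + 1)" using 0 by (simp only: of_int_le_iff)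
  then have guard: "real_of_int j \<le> (2 * real_of_int (\<alpha> n) + 1) / 2" by simp
  have t1: "real_of_int ((2 * \<alpha> n + 1 - 2 * j) * j - P * \<alpha> n + Q) / real_of_int (fr_m n \<alpha>) = t"
    unfolding t(1)[symmetric] using m by simp
  have "cb (P + t) (Q + t * \<alpha> (n - 1)) (\<alpha> n) \<in> \<int>" unfolding u(2)[symmetric] by simp
  moreover have "1 \<le> cb (P + t) (Q + t * \<alpha> (n - 1)) (\<alpha> n)"
    unfolding u(2)[symmetric] using u(1) by simp
  ultimately show ?case
    using m guard t(2,3) unfolding j fr_end.simps[of n \<alpha> j P Q x] t1 by (simp add: Let_def)
next
  case (Suc k)
  have IH: "fst (fr_end n \<alpha> (i + fr_m n \<alpha>) P Q x)"
    using Suc.prems by (intro Suc.IH) (auto simp: algebra_simps)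
  have "0 \<le> int (Suc k) * fr_m n \<alpha>" using m by simp
  then have "2 * i \<le> 2 * \<alpha> n + 1" using Suc.prems by linarith
  then have "real_of_int (2 * i) \<le> real_of_int (2 * \<alpha> n + 1)" by (simp only: of_int_le_iff)
  then have "real_of_int i \<le> (2 * real_of_int (\<alpha> n) + 1) / 2" by simp
  then show ?case using m IH by (subst fr_end.simps) (simp add: Let_def)
qed

section \<open>The recursion over the blocks and its soundness\<close>

definition fr_residues :: "nat \<Rightarrow> (nat \<Rightarrow> int) \<Rightarrow> nat \<Rightarrow> (nat \<Rightarrow> int) \<Rightarrow> int list" where
  "fr_residues n \<alpha> k y = map (\<lambda>s. (s - (\<Sum>j = 1..k. fr_g n \<alpha> j * y j)) mod fr_m n \<alpha>) (fr_sol n \<alpha>)"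

text \<open>The loop body at level \<open>Suc k\<close>, with \<open>k\<close> the number of blocks
  already fixed. Entering \<open>i\<close> into \<open>y\<close> first absorbs the extra summand of
  \<open>sum\<close> into one sum up to \<open>Suc k\<close>.\<close>

definition fr_step where
  "fr_step n \<alpha> k P Q i y =
     (if potential (fr_residues n \<alpha> (Suc k) (y(Suc k := i))) (fr_mu n \<alpha> (Suc (Suc k)))
      then fr_rec n \<alpha> (fr_residues n \<alpha> (Suc k) (y(Suc k := i))) (Suc (Suc k)) (P + i) (Q + i * \<alpha> (Suc k))
        (y(Suc k := i))
      else (False, y))"

definition fr_last where
  "fr_last n \<alpha> S P Q i y = (if S ! nat i = 0 then fr_end n \<alpha> i P Q y else (False, y))"

lemma fr_rec_step:
  assumes "Suc k < n - 1"
  shows "fr_rec n \<alpha> S (Suc k) P Q x = for_loop [1..\<lfloor>cb P Q (\<alpha> (Suc k))\<rfloor>] (fr_step n \<alpha> k P Q) x"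
proof -
  have "(\<Sum>j = 1..k. fr_g n \<alpha> j * y j) + fr_g n \<alpha> (Suc k) * i =
      (\<Sum>j = 1..Suc k. fr_g n \<alpha> j * (y(Suc k := i)) j)" for y i
    by simp
  then show ?thesis
    using assms unfolding fr_rec.simps[of n \<alpha> S "Suc k"] fr_step_def[abs_def] fr_residues_def Let_def
    by (simp only: not_le[symmetric] if_False diff_Suc_1 Suc_eq_plus1[symmetric])
qed

lemma fr_rec_last:
  assumes "n = Suc (Suc k)"
  shows "fr_rec n \<alpha> S (Suc k) P Q x = for_loop [0..fr_m n \<alpha> - 1] (fr_last n \<alpha> S P Q) x"
  using assms unfolding fr_rec.simps[of n \<alpha> S "Suc k"] fr_last_def[abs_def] by simp

text \<open>Level \<open>l\<close> and the deeper ones write only to positions from \<open>l\<close>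
  on, so a failed branch leaves the earlier choices intact for the next iteration.\<close>

lemma fr_rec_frame:
  assumes "l \<le> n - 1" "j < l"
  shows "snd (fr_rec n \<alpha> S l P Q x) j = x j"
  using assms
proof (induction "n - l" arbitrary: S l P Q x rule: less_induct)
  case less
  show ?case
  proof (cases "n - 1 \<le> l")
    case True
    then show ?thesis using less.prems
      by (subst fr_rec.simps) (auto intro!: for_loop_invariant[where I = "\<lambda>y. y j = x j"] simp: fr_end_frame)
  next
    case False
    have "snd (fr_rec n \<alpha> S' (l + 1) P' Q' y) j = y j" for S' P' Q' y
      using less.prems False by (intro less.hyps) auto
    then show ?thesis using less.prems False
      by (subst fr_rec.simps) (auto intro!: for_loop_invariant[where I = "\<lambda>y. y j = x j"] simp: Let_def)
  qed
qed

text \<open>Every chosen value lies below its \<open>cb\<close> bound, which is Landau's inequality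
  for its block; the last value equals its bound, which is the final equality.\<close>

lemma fr_rec_sound:
  assumes "k < n - 1" "landau_blocks k \<alpha> x" "P = sum x {1..k}" "Q = (\<Sum>j = 1..k. x j * \<alpha> j)"
    and "fst (fr_rec n \<alpha> S (Suc k) P Q x)"
  shows "landau_exact n \<alpha> (snd (fr_rec n \<alpha> S (Suc k) P Q x))"
  using assms
proof (induction "n - k" arbitrary: S k P Q x rule: less_induct)
  case less
  \<comment> \<open>Failed iterations may change later entries, so only agreement on the fixed
    prefix is invariant.\<close>
  define I where "I y \<longleftrightarrow> (\<forall>j\<in>{1..k}. y j = x j)" for y
  have IP: "sum y {1..k} = P" "(\<Sum>j = 1..k. y j * \<alpha> j) = Q" "landau_blocks k \<alpha> y" if "I y" for y
    using that less.prems landau_blocks_cong[of k x y \<alpha>] by (simp_all add: I_def)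
  have sums: "sum y {1..Suc k} = P + y (Suc k)"
    "(\<Sum>j = 1..Suc k. y j * \<alpha> j) = Q + y (Suc k) * \<alpha> (Suc k)" if "I y" for y
    using IP(1,2)[OF that] by simp_all
  have step: "landau_blocks (Suc k) \<alpha> y \<longleftrightarrow>
      1 \<le> y (Suc k) \<and> real_of_int (y (Suc k)) \<le> cb P Q (\<alpha> (Suc k))" if "I y" for y
    unfolding landau_blocks_Suc IP(1,2)[OF that] using IP(3)[OF that] by simp
  show ?case
  proof (cases "n - 1 \<le> Suc k")
    case True
    then have n: "n = Suc (Suc k)" using less.prems by simp
    define body where "body = fr_last n \<alpha> S P Q"
    note rec = fr_rec_last[OF n, of \<alpha> S P Q x, folded body_def]
    have frame: "I (snd (body i y))" if "I y" for i y
      using that fr_end_frame[of _ n \<alpha> i P Q y] by (auto simp: I_def n body_def fr_last_def)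
    show ?thesis
      unfolding rec
    proof (rule for_loop_sound[where I = I])
      show "fst (for_loop [0..fr_m n \<alpha> - 1] body x)" using less.prems(5) rec by simp
      show "I x" by (simp add: I_def)
      show "I (snd (body i y))" if "I y" for i y by (rule frame[OF that])
      fix i y
      assume y: "I y" "fst (body i y)"
      define y' where "y' = snd (body i y)"
      have Iy': "I y'" using frame[OF y(1)] by (simp add: y'_def)
      have b: "body i y = fr_end n \<alpha> i P Q y" using y(2) by (auto simp: body_def fr_last_def split: if_splits)
      have f: "1 \<le> y' (Suc k)" "real_of_int (y' (Suc k)) \<le> cb P Q (\<alpha> (Suc k))" "1 \<le> y' n"
        "real_of_int (y' n) = cb (P + y' (Suc k)) (Q + y' (Suc k) * \<alpha> (Suc k)) (\<alpha> n)"
        using fr_end_sound[of n \<alpha> i P Q y] y(2) unfolding y'_def b by (simp_all add: n)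
      have k1: "landau_blocks (Suc k) \<alpha> y'" using step[OF Iy'] f by simp
      have "landau_blocks n \<alpha> y'"
        unfolding n landau_blocks_Suc[of "Suc k"] sums[OF Iy'] using k1 f by (simp add: n)
      moreover have "sum y' {1..n} * (sum y' {1..n} - 1) = 2 * (\<Sum>j = 1..n. y' j * \<alpha> j)"
        using int_cb_iff(2)[OF landau_blocks_sum_le[OF k1] f(3), of "\<alpha> n", unfolded sums[OF Iy']]
          f(4) sums[OF Iy'] by (simp add: n)
      ultimately show "landau_exact n \<alpha> (snd (body i y))" by (simp add: landau_exact_def y'_def)
    qed
  next
    case False
    define body where "body = fr_step n \<alpha> k P Q"
    have k: "Suc k < n - 1" using False by simp
    note rec = fr_rec_step[OF k, of \<alpha> S P Q x, folded body_def]
    show ?thesis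
      unfolding rec
    proof (rule for_loop_sound[where I = I])
      show "fst (for_loop [1..\<lfloor>cb P Q (\<alpha> (Suc k))\<rfloor>] body x)" using less.prems(5) rec by simp
      show "I x" by (simp add: I_def)
      show "I (snd (body i y))" if "I y" for i y
        using that False by (auto simp: I_def body_def fr_step_def fr_rec_frame)
      fix i y
      assume i: "i \<in> set [1..\<lfloor>cb P Q (\<alpha> (Suc k))\<rfloor>]" and y: "I y" "fst (body i y)"
      define z where "z = y(Suc k := i)"
      have z: "I z" "z (Suc k) = i" using y(1) by (auto simp: I_def z_def)
      have b: "body i y = fr_rec n \<alpha> (fr_residues n \<alpha> (Suc k) z) (Suc (Suc k)) (P + i) (Q + i * \<alpha> (Suc k)) z"
        using y(2) by (auto simp: body_def fr_step_def z_def split: if_splits)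
      have "landau_blocks (Suc k) \<alpha> z"
        unfolding step[OF z(1)] z(2) using i by (simp add: le_floor_iff)
      then show "landau_exact n \<alpha> (snd (body i y))"
        unfolding b using y(2) less.prems False sums[OF z(1)] z(2)
        by (intro less.hyps) (auto simp: b)
    qed
  qed
qed

section \<open>Completeness: tracing a correct solution through the residues\<close>

lemma exists_half_total:
  assumes mono: "strict_mono_on {1..n} \<alpha>" and n: "n \<ge> 2" and exact: "landau_exact n \<alpha> z"
  shows "\<exists>j\<ge>0. 2 * j \<le> 2 * \<alpha> n + 1 \<and> z (n - 1) * fr_m n \<alpha> =
    (2 * \<alpha> n + 1 - 2 * j) * j - (\<Sum>i = 1..n - 2. z i * (\<alpha> n - \<alpha> i))"
proof -
  define N where "N = sum z {1..n}"
  have pos: "z i \<ge> 1" if "i \<in> {1..n}" for i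
    using exact that by (simp add: landau_exact_def landau_blocks_def)
  have tot: "N * (N - 1) = 2 * (\<Sum>i = 1..n. z i * \<alpha> i)"
    using exact by (simp add: landau_exact_def N_def)
  obtain q where q: "n = Suc (Suc q)" using n by (metis add_2_eq_Suc le_Suc_ex)
  \<comment> \<open>Measuring scores down from \<open>\<alpha> n\<close> removes block
    \<open>n\<close> and turns block \<open>n - 1\<close> into a multiple of
    \<open>fr_m n \<alpha>\<close>.\<close>
  have "N * \<alpha> n - (\<Sum>i = 1..n. z i * \<alpha> i) = (\<Sum>i = 1..n. z i * (\<alpha> n - \<alpha> i))"
    by (simp add: N_def sum_distrib_right right_diff_distrib sum_subtractf)
  also have "\<dots> = z (n - 1) * fr_m n \<alpha> + (\<Sum>i = 1..n - 2. z i * (\<alpha> n - \<alpha> i))"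
    by (simp add: q fr_m_def)
  finally have eq: "2 * (z (n - 1) * fr_m n \<alpha>) =
      N * (2 * \<alpha> n + 1 - N) - 2 * (\<Sum>i = 1..n - 2. z i * (\<alpha> n - \<alpha> i))"
    using tot by (simp add: algebra_simps)
  have "N \<ge> z n" unfolding N_def by (rule member_le_sum) (use n pos in force)+
  then have N: "N \<ge> 1" using pos[of n] n by simp
  \<comment> \<open>No score exceeds \<open>\<alpha> n\<close>, which bounds the average score
    \<open>(N - 1) / 2\<close>.\<close>
  have "(\<Sum>i = 1..n. z i * \<alpha> i) \<le> (\<Sum>i = 1..n. z i * \<alpha> n)"
  proof (intro sum_mono mult_left_mono)
    fix i assume i: "i \<in> {1..n}"
    show "\<alpha> i \<le> \<alpha> n" using strict_mono_onD[OF mono i, of n] i n by (cases "i = n") auto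
    show "0 \<le> z i" using pos[OF i] by simp
  qed
  then have "N * (N - 1) \<le> N * (2 * \<alpha> n)"
    unfolding tot by (simp add: N_def sum_distrib_right algebra_simps flip: sum_distrib_left)
  then have Nle: "N \<le> 2 * \<alpha> n + 1" using N by simp
  show ?thesis
  \<comment> \<open>\<open>N\<close> and \<open>2 * \<alpha> n + 1 - N\<close> have opposite parity
    and enter the product symmetrically; \<open>j\<close> is half of the even one.\<close>
  proof (cases "even N")
    case True
    then obtain j where "N = 2 * j" by blast
    then have "N * (2 * \<alpha> n + 1 - N) = 2 * ((2 * \<alpha> n + 1 - 2 * j) * j)" by simp
    then show ?thesis using eq \<open>N = 2 * j\<close> N Nle by (intro exI[of _ j]) linarith
  next
    case False
    then have "even (2 * \<alpha> n + 1 - N)" by simp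
    then obtain j where j: "2 * \<alpha> n + 1 - N = 2 * j" by blast
    moreover have "N = 2 * \<alpha> n + 1 - 2 * j" using j by simp
    ultimately have "N * (2 * \<alpha> n + 1 - N) = 2 * ((2 * \<alpha> n + 1 - 2 * j) * j)" by simp
    then show ?thesis using eq j N Nle by (intro exI[of _ j]) linarith
  qed
qed

text \<open>Modulo \<open>fr_m n \<alpha>\<close> block \<open>n - 1\<close> vanishes and each
  difference becomes \<open>fr_g\<close>, so only the blocks after \<open>k\<close> remain. For
  \<open>k = n - 2\<close> the entry is 0, as the last level tests.\<close>

lemma fr_sol_residue:
  assumes m: "0 < fr_m n \<alpha>" and k: "k \<le> n - 2"
    and j: "z (n - 1) * fr_m n \<alpha> =
      (2 * \<alpha> n + 1 - 2 * j) * j - (\<Sum>i = 1..n - 2. z i * (\<alpha> n - \<alpha> i))"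
  shows "(fr_sol n \<alpha> ! nat (j mod fr_m n \<alpha>) - (\<Sum>i = 1..k. fr_g n \<alpha> i * z i)) mod fr_m n \<alpha>
    = (\<Sum>i = Suc k..n - 2. fr_g n \<alpha> i * z i) mod fr_m n \<alpha>"
proof -
  define m where "m = fr_m n \<alpha>"
  have "m > 0" using assms(1) by (simp add: m_def)
  then have bounds: "0 \<le> j mod m" "j mod m < m" by auto
  have "fr_sol n \<alpha> ! nat (j mod m) = ((2 * \<alpha> n + 1 - 2 * (j mod m)) * (j mod m)) mod m"
    using bounds by (simp add: fr_sol_def flip: m_def)
  also have "\<dots> = ((2 * \<alpha> n + 1 - 2 * j) * j) mod m"
    by (intro mod_mult_cong mod_diff_cong refl) (simp_all add: mod_mult_right_eq)
  also have "(2 * \<alpha> n + 1 - 2 * j) * j = (\<Sum>i = 1..n - 2. z i * (\<alpha> n - \<alpha> i)) + z (n - 1) * m"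
    using j by (simp add: m_def)
  also have "\<dots> mod m = (\<Sum>i = 1..n - 2. z i * (\<alpha> n - \<alpha> i)) mod m" by simp
  also have "\<dots> = (\<Sum>i = 1..n - 2. (z i * (\<alpha> n - \<alpha> i)) mod m) mod m" by (simp add: mod_sum_eq)
  also have "\<dots> = (\<Sum>i = 1..n - 2. (fr_g n \<alpha> i * z i) mod m) mod m"
    by (simp add: fr_g_def mod_mult_right_eq mult.commute flip: m_def)
  also have "\<dots> = (\<Sum>i = 1..n - 2. fr_g n \<alpha> i * z i) mod m" by (simp add: mod_sum_eq)
  finally have "(fr_sol n \<alpha> ! nat (j mod m) - (\<Sum>i = 1..k. fr_g n \<alpha> i * z i)) mod m =
      ((\<Sum>i = 1..n - 2. fr_g n \<alpha> i * z i) - (\<Sum>i = 1..k. fr_g n \<alpha> i * z i)) mod m"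
    by (simp add: mod_diff_left_eq)
  also have "(\<Sum>i = 1..n - 2. fr_g n \<alpha> i * z i) =
      (\<Sum>i = 1..k. fr_g n \<alpha> i * z i) + (\<Sum>i = Suc k..n - 2. fr_g n \<alpha> i * z i)"
    using sum.ub_add_nat[of 1 k "\<lambda>i. fr_g n \<alpha> i * z i" "n - 2 - k"] k
    by (simp only: le_add_diff_inverse Suc_eq_plus1)
  finally show ?thesis by (simp add: m_def)
qed

text \<open>Follows the branch that chooses \<open>z\<close>: the entry at
  \<open>r = j mod m\<close> carries it through every test. An earlier success gives the claim as
  well.\<close>

lemma fr_rec_complete:
  assumes mono: "strict_mono_on {1..n} \<alpha>" and n: "n \<ge> 2" and exact: "landau_exact n \<alpha> z"
    and "k < n - 1" "P = sum z {1..k}" "Q = (\<Sum>j = 1..k. z j * \<alpha> j)" "\<And>j. j \<in> {1..k} \<Longrightarrow> x j = z j"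
    and "S = fr_residues n \<alpha> k z"
  shows "fst (fr_rec n \<alpha> S (Suc k) P Q x)"
proof -
  define m where "m = fr_m n \<alpha>"
  have m: "0 < m"
    using strict_mono_onD[OF mono, of "n - 1" n] n by (simp add: m_def fr_m_def)
  have blocks: "landau_blocks n \<alpha> z" using exact by (simp add: landau_exact_def)
  obtain j where j: "0 \<le> j" "2 * j \<le> 2 * \<alpha> n + 1" "z (n - 1) * fr_m n \<alpha> =
    (2 * \<alpha> n + 1 - 2 * j) * j - (\<Sum>i = 1..n - 2. z i * (\<alpha> n - \<alpha> i))"
    using exists_half_total[OF mono n exact] by blast
  define r where "r = j mod m"
  have r: "0 \<le> r" "r < m" using m by (simp_all add: r_def)
  have len: "length (fr_sol n \<alpha>) = nat m" by (simp add: fr_sol_def m_def)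
  have residue: "fr_residues n \<alpha> k z ! nat r = (\<Sum>i = Suc k..n - 2. fr_g n \<alpha> i * z i) mod m" if "k \<le> n - 2" for k
    using fr_sol_residue[OF _ that j(3)] m r len by (simp add: m_def r_def fr_residues_def)
  show ?thesis
    using assms(4-8)
  proof (induction "n - k" arbitrary: S k P Q x rule: less_induct)
    case less
    define I where "I y \<longleftrightarrow> (\<forall>j\<in>{1..k}. y j = z j)" for y :: "nat \<Rightarrow> int"
    have Ix: "I x" using less.prems by (simp add: I_def)
    have zk: "1 \<le> z (Suc k)" "real_of_int (z (Suc k)) \<le> cb P Q (\<alpha> (Suc k))"
      using landau_blocks_prefix[OF blocks, of "Suc k"] less.prems(1-3)
      by (simp_all add: landau_blocks_Suc)
    show ?case
    proof (cases "n - 1 \<le> Suc k")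
      case True
      then have nk: "n = Suc (Suc k)" using less.prems by simp
      note rec = fr_rec_last[OF nk, of \<alpha> S P Q x, folded m_def]
      have S0: "S ! nat r = 0" using residue[of k] less.prems(5) by (simp add: nk m_def)
      have k1: "landau_blocks (Suc k) \<alpha> z" using landau_blocks_prefix[OF blocks] nk by simp
      have zn: "1 \<le> z n" using blocks n by (simp add: landau_blocks_def)
      have sums: "sum z {1..Suc k} = P + z (Suc k)"
        "(\<Sum>j = 1..Suc k. z j * \<alpha> j) = Q + z (Suc k) * \<alpha> (Suc k)"
        using less.prems by simp_all
      have zn_cb: "real_of_int (z n) = cb (P + z (Suc k)) (Q + z (Suc k) * \<alpha> (Suc k)) (\<alpha> n)"
        using int_cb_iff(2)[OF landau_blocks_sum_le[OF k1] zn, of "\<alpha> n", unfolded sums]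
          exact sums by (simp add: landau_exact_def nk)
      \<comment> \<open>Started at \<open>r\<close>, the loop of \<open>fr_end\<close> meets
        \<open>j\<close> after \<open>j div m\<close> steps.\<close>
      have j_eq: "j = r + int (nat (j div m)) * fr_m n \<alpha>"
        using j(1) m by (simp add: r_def pos_imp_zdiv_nonneg_iff flip: m_def)
      have t: "z (Suc k) * fr_m n \<alpha> = (2 * \<alpha> n + 1 - 2 * j) * j - P * \<alpha> n + Q"
        using j(3) less.prems(2,3)
        by (simp add: nk right_diff_distrib sum_subtractf sum_distrib_right)
      have "fst (fr_end n \<alpha> r P Q y)" for y
        by (rule fr_end_complete[OF _ j_eq j(2) t zk(1) _ zn]) (use zk zn_cb m in \<open>simp_all add: nk m_def\<close>)
      then show ?thesis
        unfolding rec using r S0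
        by (intro for_loop_complete[where I = "\<lambda>_. True" and i\<^sub>0 = r]) (auto simp: fr_last_def)
    next
      case False
      have k: "Suc k < n - 1" using False by simp
      note rec = fr_rec_step[OF k, of \<alpha> S P Q x]
      show ?thesis
        unfolding rec
      proof (rule for_loop_complete[where I = I and i\<^sub>0 = "z (Suc k)"])
        show "z (Suc k) \<in> set [1..\<lfloor>cb P Q (\<alpha> (Suc k))\<rfloor>]" using zk by (simp add: le_floor_iff)
        show "I x" by (rule Ix)
        show "I (snd (fr_step n \<alpha> k P Q i y))" if "I y" for i y
          using that False by (auto simp: I_def fr_step_def fr_rec_frame)
        fix y assume y: "I y"
        define y' where "y' = y(Suc k := z (Suc k))"
        have y': "y' j = z j" if "j \<in> {1..Suc k}" for j
          using that y by (auto simp: y'_def I_def)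
        then have "(\<Sum>j = 1..Suc k. fr_g n \<alpha> j * y' j) = (\<Sum>j = 1..Suc k. fr_g n \<alpha> j * z j)"
          by (intro sum.cong) auto
        then have S': "fr_residues n \<alpha> (Suc k) y' = fr_residues n \<alpha> (Suc k) z"
          unfolding fr_residues_def by simp
        \<comment> \<open>The entry at \<open>r\<close> is, modulo \<open>m\<close>, a combination
          of the remaining \<open>fr_g\<close> values; the gcd divides these and \<open>m\<close>,
          hence the entry.\<close>
        have "fr_mu n \<alpha> (Suc (Suc k)) dvd fr_g n \<alpha> i" if "i \<in> {Suc (Suc k)..n - 2}" for i
          unfolding fr_mu_def by (rule Gcd_dvd) (use that in auto)
        then have "fr_mu n \<alpha> (Suc (Suc k)) dvd (\<Sum>i = Suc (Suc k)..n - 2. fr_g n \<alpha> i * z i)"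
          by (intro dvd_sum) auto
        moreover have "fr_mu n \<alpha> (Suc (Suc k)) dvd m"
          unfolding fr_mu_def m_def by (rule Gcd_dvd) simp
        ultimately have "fr_mu n \<alpha> (Suc (Suc k)) dvd fr_residues n \<alpha> (Suc k) z ! nat r"
          using residue[of "Suc k"] False by (simp add: dvd_mod)
        moreover have "fr_residues n \<alpha> (Suc k) z ! nat r \<in> set (fr_residues n \<alpha> (Suc k) z)"
          using r len by (intro nth_mem) (simp add: fr_residues_def)
        ultimately have "potential (fr_residues n \<alpha> (Suc k) z) (fr_mu n \<alpha> (Suc (Suc k)))"
          unfolding potential_def dvd_eq_mod_eq_0 by (intro bexI disjI2)
        moreover have "fst (fr_rec n \<alpha> (fr_residues n \<alpha> (Suc k) z) (Suc (Suc k)) (P + z (Suc k))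
            (Q + z (Suc k) * \<alpha> (Suc k)) y')"
          by (rule less.hyps) (use less.prems(1-3) False y' in auto)
        ultimately show "fst (fr_step n \<alpha> k P Q (z (Suc k)) y)"
          unfolding fr_step_def y'_def[symmetric] S' by simp
      qed
    qed
  qed
qed

theorem theorem4p2:
  fixes n :: nat and \<alpha> x\<^sub>0 :: "nat \<Rightarrow> int"
  assumes "n \<ge> 2"
    and "0 \<le> \<alpha> 1"
    and "strict_mono_on {1..n} \<alpha>"
    and "\<exists>x. correct_score_sequence n \<alpha> x"
  shows "\<exists>x. fast_reconstruction n \<alpha> x\<^sub>0 = (True, x) \<and> correct_score_sequence n \<alpha> x"
proof -
  obtain z where z: "landau_exact n \<alpha> z"
    using assms(3,4) correct_score_sequence_imp_landau_exact by blast
  \<comment> \<open>Nothing is subtracted for \<open>k = 0\<close>, and the entries of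
    \<open>fr_sol\<close> are already reduced.\<close>
  have "fr_sol n \<alpha> = fr_residues n \<alpha> 0 z"
    by (simp add: fr_residues_def fr_sol_def)
  then have found: "fst (fast_reconstruction n \<alpha> x\<^sub>0)"
    unfolding fast_reconstruction_def One_nat_def using assms(1)
    by (intro fr_rec_complete[OF assms(3,1) z]) auto
  \<comment> \<open>The search may return a solution other than \<open>z\<close>, so its correctness
    comes from soundness.\<close>
  then have "landau_exact n \<alpha> (snd (fast_reconstruction n \<alpha> x\<^sub>0))"
    unfolding fast_reconstruction_def One_nat_def using assms(1)
    by (intro fr_rec_sound) auto
  then have "correct_score_sequence n \<alpha> (snd (fast_reconstruction n \<alpha> x\<^sub>0))"
    using landau_exact_imp_correct_score_sequence[OF assms(3)] assms(1) by simp
  then show ?thesis using found by (intro exI conjI prod_eqI) auto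
qed

end
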